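(* Let $p$ be a prime integer, let $A$ and $B$ be a pair of rings, $J$ an ideal of $B$, $f:A\longrightarrow B$ a ring homomorphism, and let $A\bowtie^f J$ be the amalgamation of $A$ with $B$ along $J$ with respect to $f$. Then $A\bowtie^f J$ is a $p$-ring if and only if $A$ is a $p$-ring and $J$ is a $p$-ideal of $B$.
   Context: All rings are commutative with identity element $\neq 0$. For a prime integer $p$, a ring $R$ is called a $p$-ring if $x^p=x$ and $px=0$ for each $x\in R$. An ideal $I$ of a ring $R$ is called a $p$-ideal if $x^p=x$ and $px=0$ for each $x\in I$. Given rings $A,B$, an ideal $J$ of $B$ and a ring homomorphism $f:A\longrightarrow B$, the amalgamation of $A$ with $B$ along $J$ with respect to $f$ is the subring $A\bowtie^f J=\{(a,f(a)+j) : a\in A,\ j\in J\}$ of $A\times B$. *)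

theory Defs
  imports "HOL-Algebra.Algebra"
begin

text \<open>
  Rings are commutative with \<open>\<one> \<noteq> \<zero>\<close>. The locale \<^locale>\<open>cring\<close> allows the zero
  ring, so the second condition is stated separately.
\<close>

definition p_ring :: "nat \<Rightarrow> ('a, 'm) ring_scheme \<Rightarrow> bool"
  where "p_ring p R \<longleftrightarrow> cring R \<and> \<one>\<^bsub>R\<^esub> \<noteq> \<zero>\<^bsub>R\<^esub> \<and>
    (\<forall>x\<in>carrier R. x [^]\<^bsub>R\<^esub> p = x \<and> add_pow R p x = \<zero>\<^bsub>R\<^esub>)"

definition p_ideal :: "nat \<Rightarrow> 'a set \<Rightarrow> ('a, 'm) ring_scheme \<Rightarrow> bool"
  where "p_ideal p I R \<longleftrightarrow> ideal I R \<and>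
    (\<forall>x\<in>I. x [^]\<^bsub>R\<^esub> p = x \<and> add_pow R p x = \<zero>\<^bsub>R\<^esub>)"

definition amalgamation_set ::
  "('a, 'm) ring_scheme \<Rightarrow> ('b, 'n) ring_scheme \<Rightarrow> ('a \<Rightarrow> 'b) \<Rightarrow> 'b set \<Rightarrow> ('a \<times> 'b) set"
  where "amalgamation_set A B f J = {(a, f a \<oplus>\<^bsub>B\<^esub> j) | a j. a \<in> carrier A \<and> j \<in> J}"

definition amalgamation ::
  "('a, 'm) ring_scheme \<Rightarrow> ('b, 'n) ring_scheme \<Rightarrow> ('a \<Rightarrow> 'b) \<Rightarrow> 'b set \<Rightarrow> ('a \<times> 'b) ring"
  where "amalgamation A B f J = (RDirProd A B)\<lparr>carrier := amalgamation_set A B f J\<rparr>"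

lemma amalgamation_subcring:
  assumes A: "cring A" and B: "cring B" and J: "ideal J B" and f: "f \<in> ring_hom A B"
  shows "subcring (amalgamation_set A B f J) (RDirProd A B)"
proof -
  interpret A: cring A by fact
  interpret B: cring B by fact
  interpret J: ideal J B by fact
  interpret P: ring "RDirProd A B" by (intro RDirProd_ring A.ring_axioms B.ring_axioms)
  interpret h: ring_hom_ring A B f by (rule ring_hom_ringI2) (use f A.ring_axioms B.ring_axioms in auto)
  have Jc: "j \<in> J \<Longrightarrow> j \<in> carrier B" for j by (rule J.Icarr)
  have in_set: "(a, b) \<in> amalgamation_set A B f J"
    if "a \<in> carrier A" "b = f a \<oplus>\<^bsub>B\<^esub> j" "j \<in> J" for a b j
    using that unfolding amalgamation_set_def by blast
  have mult: "x \<otimes>\<^bsub>RDirProd A B\<^esub> y = (fst x \<otimes>\<^bsub>A\<^esub> fst y, snd x \<otimes>\<^bsub>B\<^esub> snd y)" for x y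
    by (cases x; cases y) (simp add: RDirProd_def DirProd_def monoid.defs)
  have add: "x \<oplus>\<^bsub>RDirProd A B\<^esub> y = (fst x \<oplus>\<^bsub>A\<^esub> fst y, snd x \<oplus>\<^bsub>B\<^esub> snd y)" for x y
    by (cases x; cases y) (simp add: RDirProd_def DirProd_def monoid.defs)
  have one: "\<one>\<^bsub>RDirProd A B\<^esub> = (\<one>\<^bsub>A\<^esub>, \<one>\<^bsub>B\<^esub>)"
    by (simp add: RDirProd_def DirProd_def monoid.defs)
  have zero: "\<zero>\<^bsub>RDirProd A B\<^esub> = (\<zero>\<^bsub>A\<^esub>, \<zero>\<^bsub>B\<^esub>)"
    by (simp add: RDirProd_def DirProd_def monoid.defs)
  have S: "subring (amalgamation_set A B f J) (RDirProd A B)"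
  proof (rule P.subringI)
    show "amalgamation_set A B f J \<subseteq> carrier (RDirProd A B)"
      by (auto simp: amalgamation_set_def RDirProd_carrier Jc)
    show "\<one>\<^bsub>RDirProd A B\<^esub> \<in> amalgamation_set A B f J"
      unfolding one by (rule in_set[of _ _ "\<zero>\<^bsub>B\<^esub>"]) (use J.zero_closed in auto)
  next
    fix x assume "x \<in> amalgamation_set A B f J"
    then obtain a j where x: "x = (a, f a \<oplus>\<^bsub>B\<^esub> j)" "a \<in> carrier A" "j \<in> J"
      unfolding amalgamation_set_def by blast
    have "\<ominus>\<^bsub>RDirProd A B\<^esub> x = (\<ominus>\<^bsub>A\<^esub> a, \<ominus>\<^bsub>B\<^esub> (f a \<oplus>\<^bsub>B\<^esub> j))"
      by (rule P.minus_equality) (use x Jc in \<open>auto simp: add zero RDirProd_carrier A.l_neg B.l_neg\<close>)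
    moreover have "\<ominus>\<^bsub>B\<^esub> (f a \<oplus>\<^bsub>B\<^esub> j) = f (\<ominus>\<^bsub>A\<^esub> a) \<oplus>\<^bsub>B\<^esub> \<ominus>\<^bsub>B\<^esub> j"
      using x Jc by (simp add: B.minus_add)
    ultimately show "\<ominus>\<^bsub>RDirProd A B\<^esub> x \<in> amalgamation_set A B f J"
      using x by (auto intro!: in_set[of _ _ "\<ominus>\<^bsub>B\<^esub> j"])
  next
    fix x y assume "x \<in> amalgamation_set A B f J" "y \<in> amalgamation_set A B f J"
    then obtain a j b k where x: "x = (a, f a \<oplus>\<^bsub>B\<^esub> j)" "a \<in> carrier A" "j \<in> J"
      and y: "y = (b, f b \<oplus>\<^bsub>B\<^esub> k)" "b \<in> carrier A" "k \<in> J"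
      unfolding amalgamation_set_def by blast
    have c: "f a \<in> carrier B" "f b \<in> carrier B" "j \<in> carrier B" "k \<in> carrier B"
      using x y Jc by auto
    show "x \<oplus>\<^bsub>RDirProd A B\<^esub> y \<in> amalgamation_set A B f J"
      unfolding add x y fst_conv snd_conv
      by (rule in_set[of _ _ "j \<oplus>\<^bsub>B\<^esub> k"]) (use x y c in \<open>auto simp: B.a_ac\<close>)
    show "x \<otimes>\<^bsub>RDirProd A B\<^esub> y \<in> amalgamation_set A B f J"
      unfolding mult x y fst_conv snd_conv
      by (rule in_set[of _ _ "f a \<otimes>\<^bsub>B\<^esub> k \<oplus>\<^bsub>B\<^esub> (j \<otimes>\<^bsub>B\<^esub> f b \<oplus>\<^bsub>B\<^esub> j \<otimes>\<^bsub>B\<^esub> k)"])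
         (use x y c in \<open>auto simp: B.r_distr B.l_distr B.a_ac J.I_l_closed J.I_r_closed\<close>)
  qed
  show ?thesis
  proof (rule subcring.intro[OF S subcring_axioms.intro])
    fix x y assume "x \<in> amalgamation_set A B f J" "y \<in> amalgamation_set A B f J"
    then show "x \<otimes>\<^bsub>RDirProd A B\<^esub> y = y \<otimes>\<^bsub>RDirProd A B\<^esub> x"
      unfolding mult by (auto simp: amalgamation_set_def A.m_comm B.m_comm Jc)
  qed
qed

end

theory Submission
  imports Defs
begin

text \<open>
  Powers and integer multiples in \<open>A \<bowtie>\<^sup>f J\<close> are computed coordinatewise.  Hence the two
  identities defining a \<open>p\<close>-ring, read at the element \<open>(a, f a + j)\<close>, say that
  they hold for \<open>a\<close> in \<open>A\<close> and for \<open>f a + j\<close> in \<open>B\<close>.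

  If \<open>A \<bowtie>\<^sup>f J\<close> is a \<open>p\<close>-ring, the elements \<open>(a, f a)\<close> yield the identities in \<open>A\<close>,
  and the elements \<open>(0, j)\<close> yield them in \<open>J\<close>.

  Conversely, \<open>f\<close> carries the identities from \<open>a\<close> to \<open>f a\<close>, so what remains is to pass from
  \<open>f a\<close> and \<open>j\<close> to their sum.  For \<open>p(f a + j) = 0\<close> this is additivity.  For \<open>p\<close>-th powers it is
  the Frobenius identity \<open>(x + y)\<^sup>p = x\<^sup>p + y\<^sup>p\<close> (\<open>add_nat_pow_prime\<close>), a consequence of the
  binomial theorem (\<open>binomial_cring\<close>): the inner coefficients are divisible by \<open>p\<close>, and each
  inner term has \<open>x = j\<close>, which \<open>p\<close> annihilates, as a factor.
\<close>

lemma (in cring) binomial_cring: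
  assumes x: "x \<in> carrier R" and y: "y \<in> carrier R"
  shows "(x \<oplus> y) [^] n = (\<Oplus>k\<in>{..n}. add_pow R (n choose k) (x [^] k \<otimes> y [^] (n - k)))"
proof (induction n)
  case 0
  show ?case using x y by simp
next
  case (Suc n)
  let ?m = "\<lambda>k. x [^] k \<otimes> y [^] (Suc n - k)"
  let ?t = "\<lambda>k. add_pow R (n choose k) (x [^] k \<otimes> y [^] (n - k))"
  let ?u = "\<lambda>k. add_pow R (n choose k) (?m k)"
  have t: "?t \<in> {..n} \<rightarrow> carrier R" and u: "\<And>S. ?u \<in> S \<rightarrow> carrier R"
    and u': "\<And>S. (\<lambda>k. add_pow R (n choose k) (?m (Suc k))) \<in> S \<rightarrow> carrier R"
    and u'': "\<And>S. (\<lambda>k. ?u (Suc k)) \<in> S \<rightarrow> carrier R"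
    and v: "\<And>S. (\<lambda>k. add_pow R (Suc n choose k) (?m k)) \<in> S \<rightarrow> carrier R"
    using x y by auto
  have "(\<Oplus>k\<in>{..n}. ?t k) \<otimes> x = (\<Oplus>k\<in>{..n}. ?t k \<otimes> x)"
    using finsum_ldistr[OF _ x t] by simp
  also have "\<dots> = (\<Oplus>k\<in>{..n}. add_pow R (n choose k) (?m (Suc k)))"
    using x y by (intro finsum_cong' u') (auto simp: add_pow_ldistr add_pow_rdistr m_ac)
  finally have X: "(\<Oplus>k\<in>{..n}. ?t k) \<otimes> x = (\<Oplus>k\<in>{..n}. add_pow R (n choose k) (?m (Suc k)))" .
  have "(\<Oplus>k\<in>{..n}. ?t k) \<otimes> y = (\<Oplus>k\<in>{..n}. ?t k \<otimes> y)"
    using finsum_ldistr[OF _ y t] by simp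
  also have "\<dots> = (\<Oplus>k\<in>{..n}. ?u k)"
    using x y by (intro finsum_cong' u) (auto simp: add_pow_ldistr m_assoc Suc_diff_le)
  \<comment> \<open>The added summand at \<open>Suc n\<close> has coefficient \<open>n choose Suc n = 0\<close>; it aligns this
      sum, after splitting off index 0, with the one in \<open>X\<close>, so that Pascal's rule applies.\<close>
  also have "\<dots> = (\<Oplus>k\<in>{..Suc n}. ?u k)"
    using finsum_Suc[OF u, of n] finsum_closed[OF u, of "{..n}"] by (simp add: binomial_eq_0)
  also have "\<dots> = (\<Oplus>k\<in>{..n}. ?u (Suc k)) \<oplus> ?u 0"
    by (rule finsum_Suc2[OF u])
  finally have Y: "(\<Oplus>k\<in>{..n}. ?t k) \<otimes> y = (\<Oplus>k\<in>{..n}. ?u (Suc k)) \<oplus> ?u 0" .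
  have c: "?u 0 \<in> carrier R" using x y by simp
  have "(\<Oplus>k\<in>{..Suc n}. add_pow R (Suc n choose k) (?m k))
      = (\<Oplus>k\<in>{..n}. add_pow R (Suc n choose Suc k) (?m (Suc k))) \<oplus> ?u 0"
    using finsum_Suc2[OF v, of n] by simp
  also have "(\<Oplus>k\<in>{..n}. add_pow R (Suc n choose Suc k) (?m (Suc k)))
      = (\<Oplus>k\<in>{..n}. add_pow R (n choose k) (?m (Suc k)) \<oplus> ?u (Suc k))"
    using x y by (intro finsum_cong') (auto simp: add.nat_pow_mult)
  also have "\<dots> = (\<Oplus>k\<in>{..n}. add_pow R (n choose k) (?m (Suc k))) \<oplus> (\<Oplus>k\<in>{..n}. ?u (Suc k))"
    by (rule finsum_addf[OF u' u''])
  finally have "(\<Oplus>k\<in>{..Suc n}. add_pow R (Suc n choose k) (?m k))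
      = (\<Oplus>k\<in>{..n}. ?t k) \<otimes> x \<oplus> (\<Oplus>k\<in>{..n}. ?t k) \<otimes> y"
    unfolding X Y using a_assoc[OF finsum_closed[OF u'] finsum_closed[OF u''] c] by simp
  also have "\<dots> = (x \<oplus> y) [^] Suc n"
    using x y Suc.IH finsum_closed[OF t] by (simp add: r_distr)
  finally show ?case by simp
qed

text \<open>
  It suffices that \<open>p\<close> annihilates one summand: every inner binomial term is a multiple
  of \<open>p x\<close>.
\<close>

lemma (in cring) add_nat_pow_prime:
  assumes p: "Factorial_Ring.prime (p::nat)"
    and x: "x \<in> carrier R" and y: "y \<in> carrier R" and px: "add_pow R p x = \<zero>"
  shows "(x \<oplus> y) [^] p = x [^] p \<oplus> y [^] p"
proof -
  let ?T = "\<lambda>k. add_pow R (p choose k) (x [^] k \<otimes> y [^] (p - k))"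
  have T: "\<And>S. ?T \<in> S \<rightarrow> carrier R" and T': "\<And>S. (\<lambda>k. ?T (Suc k)) \<in> S \<rightarrow> carrier R"
    using x y by auto
  obtain m where m: "p = Suc (Suc m)"
    using prime_ge_2_nat[OF p] that[of "p - 2"] by arith
  have inner: "?T (Suc k) = \<zero>" if "k \<le> m" for k
  proof -
    let ?z = "x [^] k \<otimes> y [^] (p - Suc k)"
    have z: "?z \<in> carrier R" using x y by simp
    have "p dvd (p choose Suc k)"
      using p that m by (intro dvd_choose_prime) auto
    then obtain q where q: "(p choose Suc k) = p * q" ..
    have "?T (Suc k) = add_pow R q (add_pow R p (x \<otimes> ?z))"
      using x y z unfolding q by (simp add: add.nat_pow_pow m_ac)
    also have "add_pow R p (x \<otimes> ?z) = add_pow R p x \<otimes> ?z"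
      using add_pow_ldistr[OF x z, of p] by simp
    also have "\<dots> = \<zero>" using px z by simp
    finally show ?thesis by simp
  qed
  have "(\<Oplus>k\<in>{..m}. ?T (Suc k)) = (\<Oplus>k\<in>{..m}. \<zero>)"
    by (rule finsum_cong') (use inner in auto)
  then have inner_sum: "(\<Oplus>k\<in>{..m}. ?T (Suc k)) = \<zero>" by simp
  have "(x \<oplus> y) [^] p = (\<Oplus>k\<in>{..Suc (Suc m)}. ?T k)"
    unfolding binomial_cring[OF x y] using m by simp
  also have "\<dots> = (\<Oplus>k\<in>{..Suc m}. ?T (Suc k)) \<oplus> ?T 0"
    by (rule finsum_Suc2[OF T])
  also have "(\<Oplus>k\<in>{..Suc m}. ?T (Suc k)) = ?T (Suc (Suc m)) \<oplus> (\<Oplus>k\<in>{..m}. ?T (Suc k))"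
    by (rule finsum_Suc[OF T'])
  also have "\<dots> = ?T p" using inner_sum x y m by simp
  finally show ?thesis using x y by simp
qed

lemma amalgamation_nat_pow:
  "(a, b) [^]\<^bsub>amalgamation A B f J\<^esub> (n::nat) = (a [^]\<^bsub>A\<^esub> n, b [^]\<^bsub>B\<^esub> n)"
  by (induction n)
     (simp_all add: nat_pow_def amalgamation_def RDirProd_def DirProd_def monoid.defs)

lemma amalgamation_add_pow:
  "add_pow (amalgamation A B f J) (n::nat) (a, b) = (add_pow A n a, add_pow B n b)"
  by (induction n)
     (simp_all add: add_pow_def nat_pow_def amalgamation_def RDirProd_def DirProd_def monoid.defs)

lemma amalgamation_zero: "\<zero>\<^bsub>amalgamation A B f J\<^esub> = (\<zero>\<^bsub>A\<^esub>, \<zero>\<^bsub>B\<^esub>)"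
  and amalgamation_one: "\<one>\<^bsub>amalgamation A B f J\<^esub> = (\<one>\<^bsub>A\<^esub>, \<one>\<^bsub>B\<^esub>)"
  and amalgamation_carrier: "carrier (amalgamation A B f J) = amalgamation_set A B f J"
  by (simp_all add: amalgamation_def RDirProd_def DirProd_def monoid.defs)

lemma amalgamation_cring:
  assumes "cring A" and "cring B" and "ideal J B" and "f \<in> ring_hom A B"
  shows "cring (amalgamation A B f J)"
proof -
  interpret P: ring "RDirProd A B"
    using assms by (intro RDirProd_ring) (auto dest: cring.axioms)
  have S: "subcring (amalgamation_set A B f J) (RDirProd A B)"
    using assms by (rule amalgamation_subcring)
  then have "amalgamation_set A B f J \<subseteq> carrier (RDirProd A B)"
    by (intro subringE(1) subcring.axioms)
  from P.subcring_iff[OF this] S show ?thesis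
    by (simp add: amalgamation_def)
qed

text \<open>
  This removes the product ring from the problem: the claim becomes one about \<open>a\<close> in \<open>A\<close> and
  \<open>f a + j\<close> in \<open>B\<close>.  The nonzero identity of \<open>A\<close> makes the identity of the amalgamation nonzero.
\<close>

lemma p_ring_amalgamation_iff:
  assumes "cring A" and "\<one>\<^bsub>A\<^esub> \<noteq> \<zero>\<^bsub>A\<^esub>" and "cring B" and "ideal J B" and "f \<in> ring_hom A B"
  shows "p_ring p (amalgamation A B f J) \<longleftrightarrow>
    (\<forall>a\<in>carrier A. \<forall>j\<in>J.
      a [^]\<^bsub>A\<^esub> p = a \<and> (f a \<oplus>\<^bsub>B\<^esub> j) [^]\<^bsub>B\<^esub> p = f a \<oplus>\<^bsub>B\<^esub> j \<and>
      add_pow A p a = \<zero>\<^bsub>A\<^esub> \<and> add_pow B p (f a \<oplus>\<^bsub>B\<^esub> j) = \<zero>\<^bsub>B\<^esub>)"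
proof -
  have "cring (amalgamation A B f J)"
    using assms by (intro amalgamation_cring)
  moreover have "(\<forall>x\<in>amalgamation_set A B f J. P x) \<longleftrightarrow>
      (\<forall>a\<in>carrier A. \<forall>j\<in>J. P (a, f a \<oplus>\<^bsub>B\<^esub> j))" for P
    unfolding amalgamation_set_def by blast
  ultimately show ?thesis
    unfolding p_ring_def amalgamation_carrier amalgamation_zero amalgamation_one
    using assms(2) by (simp add: amalgamation_nat_pow amalgamation_add_pow)
qed

theorem theorem2p10:
  fixes p :: nat
    and A :: "('a, 'm) ring_scheme" and B :: "('b, 'n) ring_scheme"
    and J :: "'b set" and f :: "'a \<Rightarrow> 'b"
  assumes "Factorial_Ring.prime p"
    and "cring A" and "\<one>\<^bsub>A\<^esub> \<noteq> \<zero>\<^bsub>A\<^esub>"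
    and "cring B" and "\<one>\<^bsub>B\<^esub> \<noteq> \<zero>\<^bsub>B\<^esub>"
    and "ideal J B"
    and "f \<in> ring_hom A B"
  shows "p_ring p (amalgamation A B f J) \<longleftrightarrow> p_ring p A \<and> p_ideal p J B"
proof -
  interpret A: cring A by fact
  interpret B: cring B by fact
  interpret J: ideal J B by fact
  interpret h: ring_hom_ring A B f
    by (rule ring_hom_ringI2) (use assms A.ring_axioms B.ring_axioms in auto)
  note amalg_iff = p_ring_amalgamation_iff[OF assms(2,3,4,6,7), of p]
  show ?thesis
  proof
    assume "p_ring p (amalgamation A B f J)"
    then have *: "a [^]\<^bsub>A\<^esub> p = a \<and> add_pow A p a = \<zero>\<^bsub>A\<^esub> \<and>
        (f a \<oplus>\<^bsub>B\<^esub> j) [^]\<^bsub>B\<^esub> p = f a \<oplus>\<^bsub>B\<^esub> j \<and> add_pow B p (f a \<oplus>\<^bsub>B\<^esub> j) = \<zero>\<^bsub>B\<^esub>"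
      if "a \<in> carrier A" "j \<in> J" for a j
      using that unfolding amalg_iff by blast
    have "p_ring p A"
      using *[OF _ J.zero_closed] assms(2,3) by (simp add: p_ring_def)
    moreover have "p_ideal p J B"
      using *[OF A.zero_closed] assms(6) J.Icarr by (simp add: p_ideal_def)
    ultimately show "p_ring p A \<and> p_ideal p J B" ..
  next
    assume pp: "p_ring p A \<and> p_ideal p J B"
    show "p_ring p (amalgamation A B f J)"
      unfolding amalg_iff
    proof (intro ballI conjI)
      fix a j assume a: "a \<in> carrier A" and j: "j \<in> J"
      have jc: "j \<in> carrier B" and fc: "f a \<in> carrier B"
        using a j J.Icarr by auto
      show a1: "a [^]\<^bsub>A\<^esub> p = a" and a2: "add_pow A p a = \<zero>\<^bsub>A\<^esub>"
        using pp a by (auto simp: p_ring_def)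
      have j1: "j [^]\<^bsub>B\<^esub> p = j" and j2: "add_pow B p j = \<zero>\<^bsub>B\<^esub>"
        using pp j by (auto simp: p_ideal_def)
      have f1: "f a [^]\<^bsub>B\<^esub> p = f a"
        using h.hom_nat_pow[OF a, of p] a1 by simp
      have "f (add_pow A n a) = add_pow B n (f a)" for n :: nat
        using a by (induction n) simp_all
      from this[of p] have f2: "add_pow B p (f a) = \<zero>\<^bsub>B\<^esub>"
        using a2 by simp
      show "add_pow B p (f a \<oplus>\<^bsub>B\<^esub> j) = \<zero>\<^bsub>B\<^esub>"
        using B.add.nat_pow_distrib[OF fc jc, of p] f2 j2 by simp
      show "(f a \<oplus>\<^bsub>B\<^esub> j) [^]\<^bsub>B\<^esub> p = f a \<oplus>\<^bsub>B\<^esub> j"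
        using B.add_nat_pow_prime[OF assms(1) jc fc j2] f1 j1 B.a_comm[OF fc jc] by simp
    qed
  qed
qed

end
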